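(* Let $p$ be a prime, $n\ge1$ an integer, $q=p^n$, and let $F,G:\mathbb{F}_q\to\mathbb{F}_q$ be CCZ-equivalent. Define the global nontrivial profile energy by $$\mathcal{E}(F)=\sum_{u\in\mathbb{F}_q^*}\sum_{v\in\mathbb{F}_q^*}\sum_{j\in\mathbb{F}_p}|L_F(u,v;j)|^2,$$ and $\mathcal{E}(G)$ likewise. Then $\mathcal{E}(F)=\mathcal{E}(G)$.
   Context: $\mathrm{Tr}_1^n$ is the absolute trace $\mathbb{F}_{p^n}\to\mathbb{F}_p$; $\mathbb{F}_q^*=\mathbb{F}_q\setminus\{0\}$. $F,G:\mathbb{F}_q\to\mathbb{F}_q$ are CCZ-equivalent if there is an $\mathbb{F}_p$-affine permutation of $\mathbb{F}_q\times\mathbb{F}_q$ that maps the graph $\{(x,F(x)):x\in\mathbb{F}_q\}$ onto the graph $\{(x,G(x)):x\in\mathbb{F}_q\}$. The derivative is $D_uF(x)=F(x+u)-F(x)$, and $L_F(u,v;j)=\#\{x\in\mathbb{F}_q:\mathrm{Tr}_1^n(vD_uF(x))=j\}-p^{n-1}$. *)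

theory Defs
  imports "HOL-Computational_Algebra.Primes" "HOL-Library.Product_Plus"
begin

text \<open>
  The field \<open>\<F>\<^sub>q\<close> with \<open>q = p ^ n\<close> is a type \<open>'a\<close> of class \<^class>\<open>finite_field\<close>
  with \<open>p ^ n\<close> elements, and \<open>\<F>\<^sub>p\<close> is its prime subfield.
  The parameters \<open>p\<close> and \<open>n\<close> are explicit arguments of the constants below, which have their
  intended meaning only if \<open>p\<close> is prime and \<open>'a\<close> has \<open>p ^ n\<close> elements.
\<close>

definition prime_subfield :: "nat \<Rightarrow> 'a::finite_field set"
  where "prime_subfield p = of_nat ` {..<p}"

text \<open>The absolute trace \<open>\<F>\<^sub>q \<rightarrow> \<F>\<^sub>p\<close>, its values being regarded as elements of \<open>\<F>\<^sub>q\<close>.\<close>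

definition abs_trace :: "nat \<Rightarrow> nat \<Rightarrow> 'a::finite_field \<Rightarrow> 'a"
  where "abs_trace p n x = (\<Sum>i<n. x ^ (p ^ i))"

definition Fp_linear :: "nat \<Rightarrow> ('a::finite_field \<times> 'a \<Rightarrow> 'a \<times> 'a) \<Rightarrow> bool"
  where "Fp_linear p L \<longleftrightarrow>
    (\<forall>z w. L (z + w) = L z + L w) \<and>
    (\<forall>c\<in>prime_subfield p. \<forall>x y. L (c * x, c * y) = (c * fst (L (x, y)), c * snd (L (x, y))))"

definition Fp_affine :: "nat \<Rightarrow> ('a::finite_field \<times> 'a \<Rightarrow> 'a \<times> 'a) \<Rightarrow> bool"
  where "Fp_affine p A \<longleftrightarrow> (\<exists>L b. Fp_linear p L \<and> (\<forall>z. A z = L z + b))"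

definition graph_of :: "('a \<Rightarrow> 'b) \<Rightarrow> ('a \<times> 'b) set"
  where "graph_of F = {(x, F x) | x. True}"

definition CCZ_equivalent :: "nat \<Rightarrow> ('a::finite_field \<Rightarrow> 'a) \<Rightarrow> ('a \<Rightarrow> 'a) \<Rightarrow> bool"
  where "CCZ_equivalent p F G \<longleftrightarrow>
    (\<exists>A. Fp_affine p A \<and> bij A \<and> A ` graph_of F = graph_of G)"

definition derivative :: "('a::finite_field \<Rightarrow> 'a) \<Rightarrow> 'a \<Rightarrow> 'a \<Rightarrow> 'a"
  where "derivative F u x = F (x + u) - F x"

definition profile :: "nat \<Rightarrow> nat \<Rightarrow> ('a::finite_field \<Rightarrow> 'a) \<Rightarrow> 'a \<Rightarrow> 'a \<Rightarrow> 'a \<Rightarrow> int"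
  where "profile p n F u v j =
    int (card {x. abs_trace p n (v * derivative F u x) = j}) - int (p ^ (n - 1))"

definition profile_energy :: "nat \<Rightarrow> nat \<Rightarrow> ('a::finite_field \<Rightarrow> 'a) \<Rightarrow> int"
  where "profile_energy p n F =
    (\<Sum>u\<in>UNIV - {0}. \<Sum>v\<in>UNIV - {0}. \<Sum>j\<in>prime_subfield p. \<bar>profile p n F u v j\<bar> ^ 2)"

end

theory Submission
  imports Defs "HOL-Computational_Algebra.Polynomial" "HOL-Number_Theory.Residues"
    "HOL-Library.Cardinality"
begin

text \<open>
  Since the fibres of \<open>x \<mapsto> Tr (v * D\<^sub>uF x)\<close> partition the field, the energy is, up to a constant,
  the number of \<open>(u, v, x, y)\<close> with \<open>u, v \<noteq> 0\<close> and \<open>Tr (v * (D\<^sub>uF x - D\<^sub>uF y)) = 0\<close>.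
  The number of such \<open>v\<close> depends only on whether \<open>D\<^sub>uF x = D\<^sub>uF y\<close>, so the energy is an affine
  function, the same for all \<open>F\<close>, of the number of quadruples of points of the graph of \<open>F\<close> with
  \<open>P - Q = R - S \<noteq> 0\<close>. Affine permutations preserve this number.
\<close>

subsection \<open>The absolute trace\<close>

lemma finite_field_CHAR_eq:
  assumes "prime p" and "card (UNIV :: 'a::finite_field set) = p ^ n"
  shows "CHAR('a) = p"
proof -
  have "CHAR('a) dvd p ^ n"
    using CHAR_dvd_CARD[where 'a = 'a] assms(2) by simp
  then have "CHAR('a) dvd p"
    using prime_dvd_power CHAR_prime[where 'a = 'a] by blast
  then show ?thesis
    using assms(1) CHAR_prime[where 'a = 'a] primes_dvd_imp_eq by blast
qed

lemma of_nat_power_CHAR: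
  assumes "CHAR('a) = p" "prime p"
  shows "(of_nat k :: 'a::comm_semiring_1) ^ p = of_nat k"
proof (induction k)
  case 0
  then show ?case using prime_gt_0_nat[OF assms(2)] by (simp add: power_0_left)
next
  case (Suc k)
  have "(1 + of_nat k :: 'a) ^ p = 1 ^ p + of_nat k ^ p"
    using assms by (intro freshmans_dream) auto
  then show ?case using Suc.IH by simp
qed

lemma card_prime_subfield:
  assumes "CHAR('a::finite_field) = p"
  shows "card (prime_subfield p :: 'a set) = p"
proof -
  have "inj_on (of_nat :: nat \<Rightarrow> 'a) {..<p}"
  proof (rule linorder_inj_onI)
    fix x y assume "x < y" "x \<in> {..<p}" "y \<in> {..<p}"
    then show "of_nat x \<noteq> (of_nat y :: 'a)"
      using of_nat_eq_iff_char_dvd[of x y, where 'a = 'a] assms by (auto dest: dvd_imp_le)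
  qed auto
  then show ?thesis
    by (simp add: prime_subfield_def card_image)
qed

text \<open>The \<open>p\<close> multiples of 1 are all roots of X^p - X, which has at most
  \<open>p\<close> roots. Membership thereby becomes a Frobenius test, the form in which it is
  checked for the trace.\<close>

lemma prime_subfield_eq:
  assumes "CHAR('a::finite_field) = p" "prime p"
  shows "prime_subfield p = {x :: 'a. x ^ p = x}"
proof (rule card_subset_eq)
  show sub: "prime_subfield p \<subseteq> {x :: 'a. x ^ p = x}"
    using of_nat_power_CHAR[OF assms] by (auto simp: prime_subfield_def)
  define P where "P = Polynomial.monom (1 :: 'a) p - [:0, 1:]"
  \<comment> \<open>Since \<open>p\<close> exceeds 1, the term X^p dominates X.\<close>
  have deg: "degree P = p"
    unfolding P_def using prime_gt_1_nat[OF assms(2)]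
    by (subst diff_conv_add_uminus, subst degree_add_eq_left) (auto simp: Polynomial.degree_monom_eq)
  have "P \<noteq> 0"
    using deg prime_gt_0_nat[OF assms(2)] by auto
  then have "card {x. poly P x = 0} \<le> p"
    using card_poly_roots_bound deg by metis
  moreover have "{x. poly P x = 0} = {x :: 'a. x ^ p = x}"
    by (simp add: P_def poly_monom)
  ultimately have "card {x :: 'a. x ^ p = x} \<le> p"
    by simp
  then show "card (prime_subfield p :: 'a set) = card {x :: 'a. x ^ p = x}"
    using card_prime_subfield[OF assms(1)] card_mono[OF _ sub] by simp
qed simp

lemma abs_trace_add:
  assumes "CHAR('a::finite_field) = p" "prime p"
  shows "abs_trace p n (x + y :: 'a) = abs_trace p n x + abs_trace p n y"
proof -
  have "(x + y) ^ p ^ i = x ^ p ^ i + y ^ p ^ i" for i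
    using assms by (intro freshmans_dream') auto
  then show ?thesis
    by (simp add: abs_trace_def sum.distrib)
qed

lemma abs_trace_diff:
  assumes "CHAR('a::finite_field) = p" "prime p"
  shows "abs_trace p n (x - y :: 'a) = abs_trace p n x - abs_trace p n y"
  using abs_trace_add[OF assms, of n "x - y" y] by simp

text \<open>Frobenius is additive and permutes the summands of the trace cyclically, because x^(p^n)
  = x; so it fixes the trace.\<close>

lemma abs_trace_in_prime_subfield:
  assumes "CHAR('a::finite_field) = p" "prime p" "card (UNIV :: 'a set) = p ^ n"
  shows "abs_trace p n (x :: 'a) \<in> prime_subfield p"
proof -
  have "abs_trace p n x ^ p = (\<Sum>i<n. x ^ p ^ Suc i)"
    unfolding abs_trace_def using assms
    by (subst freshmans_dream_sum) (auto simp: mult.commute simp flip: power_mult)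
  \<comment> \<open>The sum of x^(p^i) over i \<le> n is split once at its first and once at its
    last term; both of these terms equal x.\<close>
  also have "\<dots> = abs_trace p n x"
    using sum.lessThan_Suc_shift[of "\<lambda>i. x ^ p ^ i" n] sum.lessThan_Suc[of "\<lambda>i. x ^ p ^ i" n]
      finite_field_power_card_eq_same[of x] assms(3)
    by (simp add: abs_trace_def)
  finally show ?thesis
    by (simp add: prime_subfield_eq[OF assms(1,2)])
qed

subsection \<open>Counting\<close>

lemma sum_card_fibres:
  fixes h :: "'a::finite \<Rightarrow> 'b"
  assumes "finite P" "range h \<subseteq> P"
  shows "(\<Sum>j\<in>P. card {x. h x = j}) = card (UNIV :: 'a set)"
proof -
  have "(\<Union>j\<in>P. {x. h x = j}) = UNIV"
    using assms(2) by auto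
  then have "card (UNIV :: 'a set) = (\<Sum>j\<in>P. card {x. h x = j})"
    using assms(1) card_UN_disjoint[of P "\<lambda>j. {x. h x = j}"] by fastforce
  then show ?thesis ..
qed

text \<open>The pairs with equal values form the disjoint union of the squares of the
  fibres.\<close>

lemma sum_card_fibres_squared:
  fixes h :: "'a::finite \<Rightarrow> 'b"
  assumes "finite P" "range h \<subseteq> P"
  shows "(\<Sum>j\<in>P. (card {x. h x = j})\<^sup>2) = card {(x, y). h x = h y}"
proof -
  have "(\<Union>j\<in>P. {x. h x = j} \<times> {x. h x = j}) = {(x, y). h x = h y}"
    using assms(2) by auto
  then have "card {(x, y). h x = h y} = (\<Sum>j\<in>P. card ({x. h x = j} \<times> {x. h x = j}))"
    using assms(1) card_UN_disjoint[of P "\<lambda>j. {x. h x = j} \<times> {x. h x = j}"] by fastforce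
  then show ?thesis
    by (simp add: card_cartesian_product power2_eq_square)
qed

text \<open>Only the quadratic term of the expanded square depends on \<open>h\<close>, since the
  fibre sizes add up to the size of the domain.\<close>

lemma sum_fibre_deviation_squared:
  fixes h :: "'a::finite \<Rightarrow> 'b" and m :: int
  assumes "finite P" "range h \<subseteq> P"
  shows "(\<Sum>j\<in>P. (int (card {x. h x = j}) - m)\<^sup>2) =
    int (card {(x, y). h x = h y}) - 2 * m * int (card (UNIV :: 'a set)) + int (card P) * m\<^sup>2"
proof -
  have "(\<Sum>j\<in>P. (int (card {x. h x = j}) - m)\<^sup>2) =
      int (\<Sum>j\<in>P. (card {x. h x = j})\<^sup>2) - 2 * m * int (\<Sum>j\<in>P. card {x. h x = j})
      + int (card P) * m\<^sup>2"
    by (simp add: power2_diff sum.distrib sum_subtractf sum_distrib_left mult_ac)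
  then show ?thesis
    by (simp only: sum_card_fibres[OF assms] sum_card_fibres_squared[OF assms])
qed

lemma card_nonzero: "int (card (UNIV - {0 :: 'a::{finite, zero}})) = int (card (UNIV :: 'a set)) - 1"
proof -
  have "card (UNIV :: 'a set) \<ge> 1"
    using one_le_card_finite[where 'a = 'a] by simp
  moreover have "card (UNIV - {0 :: 'a}) = card (UNIV :: 'a set) - 1"
    by (rule card_Diff_singleton) simp
  ultimately show ?thesis
    by (simp only: of_nat_diff of_nat_1)
qed

text \<open>Multiplication by a nonzero \<open>c\<close> permutes the nonzero elements, so the count
  is the same for all such \<open>c\<close>.\<close>

lemma card_zeros_of_multiples:
  fixes T :: "'a::finite_field \<Rightarrow> 'b::zero"
  assumes "T 0 = 0"
  shows "card {v. v \<noteq> 0 \<and> T (v * c) = 0} =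
    (if c = 0 then card (UNIV - {0 :: 'a}) else card {w. w \<noteq> 0 \<and> T w = 0})"
proof (cases "c = 0")
  case True
  moreover have "UNIV - {0} = {v :: 'a. v \<noteq> 0}"
    by auto
  ultimately show ?thesis using assms by simp
next
  case False
  have "bij_betw (\<lambda>v. v * c) {v. v \<noteq> 0 \<and> T (v * c) = 0} {w. w \<noteq> 0 \<and> T w = 0}"
    by (rule bij_betwI[where g = "\<lambda>w. w / c"]) (use False in auto)
  then show ?thesis
    using False by (simp add: bij_betw_same_card)
qed

text \<open>Double counting: by additivity of \<open>T\<close> a collision means
  \<open>T (v * (d x - d y)) = 0\<close>, and for a fixed pair the number of such \<open>v\<close>
  takes only two values.\<close>

lemma sum_card_trace_collisions:
  fixes T :: "'a::finite_field \<Rightarrow> 'b::ab_group_add" and d :: "'a \<Rightarrow> 'a"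
  assumes T: "\<And>x y. T (x - y) = T x - T y"
  defines "K \<equiv> int (card {w. w \<noteq> 0 \<and> T w = 0})" and "q \<equiv> int (card (UNIV :: 'a set))"
  shows "(\<Sum>v\<in>UNIV - {0}. int (card {(x, y). T (v * d x) = T (v * d y)})) =
    K * q\<^sup>2 + (q - 1 - K) * int (card {(x, y). d x = d y})"
proof -
  have T0: "T 0 = 0"
    using T[of 0 0] by simp
  have "(\<Sum>v\<in>UNIV - {0}. card {(x, y). T (v * d x) = T (v * d y)}) =
      (\<Sum>v\<in>UNIV - {0}. \<Sum>z\<in>UNIV. of_bool (T (v * (d (fst z) - d (snd z))) = 0))"
    by (intro sum.cong refl) (simp add: case_prod_unfold right_diff_distrib T)
  also have "\<dots> = (\<Sum>z\<in>UNIV. \<Sum>v\<in>UNIV - {0}. of_bool (T (v * (d (fst z) - d (snd z))) = 0))"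
    by (rule sum.swap)
  also have "\<dots> = (\<Sum>z\<in>UNIV. card {v. v \<noteq> 0 \<and> T (v * (d (fst z) - d (snd z))) = 0})"
    by (intro sum.cong refl) (auto intro: arg_cong[of _ _ card])
  finally have "(\<Sum>v\<in>UNIV - {0}. int (card {(x, y). T (v * d x) = T (v * d y)})) =
      (\<Sum>z\<in>UNIV. int (card {v. v \<noteq> 0 \<and> T (v * (d (fst z) - d (snd z))) = 0}))"
    by (simp only: flip: of_nat_sum)
  \<comment> \<open>The count is \<open>q - 1\<close> where the values of \<open>d\<close> agree and
    \<open>K\<close> elsewhere; the indicator merges the two cases.\<close>
  also have "\<dots> = (\<Sum>z\<in>UNIV. K + (q - 1 - K) * of_bool (d (fst z) = d (snd z)))"
    by (intro sum.cong refl)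
      (simp only: card_zeros_of_multiples[of T, OF T0] K_def q_def card_nonzero
        if_distrib[of int], simp)
  also have "\<dots> = K * q\<^sup>2 + (q - 1 - K) * int (card {(x, y). d x = d y})"
    by (simp add: sum.distrib case_prod_unfold q_def power2_eq_square card_prod
        flip: sum_distrib_left)
  finally show ?thesis .
qed

subsection \<open>Additive quadruples in the graph\<close>

text \<open>Graph points are recorded by their abscissae, as \<open>F\<close> determines the
  ordinates. The condition \<open>a \<noteq> b\<close> corresponds to a nonzero direction
  \<open>u\<close>.\<close>

definition graph_parallelograms :: "('a::ab_group_add \<Rightarrow> 'b::ab_group_add) \<Rightarrow> ('a \<times> 'a \<times> 'a \<times> 'a) set"
  where "graph_parallelograms F =
    {(a, b, c, d). a \<noteq> b \<and> a - b = c - d \<and> F a - F b = F c - F d}"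

text \<open>The chord of the graph over x and x + u has difference (u, D_u F(x)), so a collision of
  the derivative is a pair of equal chords, and u is recovered as \<open>a - b\<close>.\<close>

lemma sum_card_derivative_collisions:
  fixes F :: "'a::finite_field \<Rightarrow> 'a"
  shows "(\<Sum>u\<in>UNIV - {0}. card {(x, y). derivative F u x = derivative F u y}) =
    card (graph_parallelograms F)"
proof -
  have "(\<Sum>u\<in>UNIV - {0}. card {(x, y). derivative F u x = derivative F u y}) =
      card (SIGMA u : UNIV - {0}. {(x, y). derivative F u x = derivative F u y})"
    by simp
  also have "\<dots> = card (graph_parallelograms F)"
    by (rule bij_betw_same_card[where f = "\<lambda>(u, x, y). (x + u, x, y + u, y)"],
        rule bij_betwI[where g = "\<lambda>(a, b, c, d). (a - b, b, d)"])
      (auto simp: graph_parallelograms_def derivative_def algebra_simps)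
  finally show ?thesis .
qed

lemma CCZ_equivalent_card_parallelograms:
  fixes F G :: "'a::finite_field \<Rightarrow> 'a"
  assumes "CCZ_equivalent p F G"
  shows "card (graph_parallelograms F) = card (graph_parallelograms G)"
proof -
  obtain A L b where L: "Fp_linear p L" and A: "\<And>z. A z = L z + b"
    and "bij A" and img: "A ` graph_of F = graph_of G"
    using assms unfolding CCZ_equivalent_def Fp_affine_def by blast
  have inj: "A z = A w \<longleftrightarrow> z = w" for z w
    using \<open>bij A\<close> by (simp add: bij_is_inj inj_eq)
  \<comment> \<open>The translation \<open>b\<close> cancels, so differences are transformed by the
    additive map \<open>L\<close> alone.\<close>
  have "A (z - w + w) - A w = L (z - w)" for z w
    using L by (simp only: A Fp_linear_def) simp
  then have diff: "A z - A w = L (z - w)" for z w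
    by simp
  \<comment> \<open>\<open>L\<close> inherits injectivity from \<open>A\<close>, from which it
    differs by a translation.\<close>
  have diff_eq: "A z - A w = A z' - A w' \<longleftrightarrow> z - w = z' - w'" for z w z' w'
  proof -
    have "L (z - w) = L (z' - w') \<longleftrightarrow> z - w = z' - w'"
      using inj[of "z - w" "z' - w'"] by (simp add: A)
    then show ?thesis by (simp add: diff)
  qed
  \<comment> \<open>This is the action of \<open>A\<close> on abscissae. It is injective because the
    image point lies on the graph of \<open>G\<close> and is thus determined by its
    abscissa.\<close>
  define \<pi> where "\<pi> x = fst (A (x, F x))" for x
  have A_graph: "A (x, F x) = (\<pi> x, G (\<pi> x))" for x
  proof -
    have "(x, F x) \<in> graph_of F"
      by (simp add: graph_of_def)
    then have "A (x, F x) \<in> graph_of G"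
      using img by blast
    then show ?thesis
      by (auto simp: graph_of_def \<pi>_def)
  qed
  have inj_\<pi>: "\<pi> x = \<pi> y \<longleftrightarrow> x = y" for x y
    using inj[of "(x, F x)" "(y, F y)"] by (auto simp: A_graph)
  then have "bij \<pi>"
    by (simp add: bij_def inj_def finite_UNIV_inj_surj)
  define \<tau> where "\<tau> = inv_into UNIV \<pi>"
  have \<pi>_inv: "\<pi> (\<tau> y) = y" "\<tau> (\<pi> x) = x" for x y
    by (simp_all add: \<tau>_def bij_is_surj surj_f_inv_f bij_is_inj \<open>bij \<pi>\<close>)
  \<comment> \<open>The two equations of a parallelogram are one equation between differences of
    graph points, so \<open>diff_eq\<close> applies; \<open>inj_\<pi>\<close> handles
    \<open>a \<noteq> b\<close>.\<close>
  have iff: "(\<pi> a, \<pi> b, \<pi> c, \<pi> d) \<in> graph_parallelograms G \<longleftrightarrow>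
      (a, b, c, d) \<in> graph_parallelograms F" for a b c d
    using diff_eq[of "(a, F a)" "(b, F b)" "(c, F c)" "(d, F d)"]
    by (auto simp: graph_parallelograms_def A_graph inj_\<pi>)
  have "bij_betw (\<lambda>(a, b, c, d). (\<pi> a, \<pi> b, \<pi> c, \<pi> d))
      (graph_parallelograms F) (graph_parallelograms G)"
  proof (rule bij_betwI[where g = "\<lambda>(a, b, c, d). (\<tau> a, \<tau> b, \<tau> c, \<tau> d)"])
    show "(\<lambda>(a, b, c, d). (\<tau> a, \<tau> b, \<tau> c, \<tau> d))
        \<in> graph_parallelograms G \<rightarrow> graph_parallelograms F"
      by (auto simp: \<pi>_inv simp flip: iff)
  qed (auto simp: iff \<pi>_inv)
  then show ?thesis
    by (rule bij_betw_same_card)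
qed

text \<open>Summing over j, then v, then u leaves the parallelogram count as the only quantity that
  depends on \<open>F\<close>; \<open>K\<close> depends on the field alone.\<close>

lemma profile_energy_eq:
  fixes F :: "'a::finite_field \<Rightarrow> 'a"
  assumes p: "prime p" and card: "card (UNIV :: 'a set) = p ^ n"
  defines "q \<equiv> int (p ^ n)" and "m \<equiv> int (p ^ (n - 1))"
    and "K \<equiv> int (card {w :: 'a. w \<noteq> 0 \<and> abs_trace p n w = 0})"
  shows "profile_energy p n F =
    (q - 1) * (K * q\<^sup>2 + (q - 1) * (int p * m\<^sup>2 - 2 * m * q))
    + (q - 1 - K) * int (card (graph_parallelograms F))"
proof -
  have char: "CHAR('a) = p"
    using finite_field_CHAR_eq p card by blast
  have card_units: "int (card (UNIV - {0 :: 'a})) = q - 1"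
    by (simp only: card_nonzero card q_def)
  \<comment> \<open>The term free of \<open>F\<close> comes from expanding the square: each of the
    \<open>p\<close> trace values contributes \<open>m\<^sup>2\<close>, and the fibre sizes have sum
    \<open>q\<close>.\<close>
  have "profile_energy p n F = (\<Sum>u\<in>UNIV - {0}. \<Sum>v\<in>UNIV - {0}.
      int (card {(x, y). abs_trace p n (v * derivative F u x) = abs_trace p n (v * derivative F u y)})
      + (int p * m\<^sup>2 - 2 * m * q))"
    unfolding profile_energy_def profile_def power2_abs m_def q_def
    by (intro sum.cong refl, subst sum_fibre_deviation_squared)
      (auto simp: abs_trace_in_prime_subfield[OF char p card] card_prime_subfield[OF char] card)
  also have "\<dots> = (\<Sum>u\<in>UNIV - {0}. K * q\<^sup>2
      + (q - 1 - K) * int (card {(x, y). derivative F u x = derivative F u y})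
      + (q - 1) * (int p * m\<^sup>2 - 2 * m * q))"
    by (intro sum.cong refl)
      (simp only: sum.distrib sum_card_trace_collisions[of "abs_trace p n", OF abs_trace_diff[OF char p]]
          sum_constant card_units card K_def q_def)
  also have "\<dots> = (q - 1) * (K * q\<^sup>2 + (q - 1) * (int p * m\<^sup>2 - 2 * m * q))
      + (q - 1 - K) * int (\<Sum>u\<in>UNIV - {0}. card {(x, y). derivative F u x = derivative F u y})"
    by (simp only: sum.distrib sum_constant card_units of_nat_sum distrib_left add_ac flip: sum_distrib_left)
  finally show ?thesis
    by (simp only: sum_card_derivative_collisions)
qed

theorem corollary5p6:
  fixes p n :: nat and F G :: "'a::finite_field \<Rightarrow> 'a"
  assumes "prime p"
    and "n \<ge> 1"
    and "card (UNIV :: 'a set) = p ^ n"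
    and "CCZ_equivalent p F G"
  shows "profile_energy p n F = profile_energy p n G"
  unfolding profile_energy_eq[OF assms(1,3)] CCZ_equivalent_card_parallelograms[OF assms(4)] ..

end
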